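(* Let $a,b$ be nonzero real numbers, let $\alpha,\beta$ be the roots of the characteristic equation $\lambda^2-ab\lambda-ab=0$, and let $O_n(a,b)$ be the bi-periodic Fibonacci octonions. With $$\alpha^{*}=\sum_{t=0}^{7}\frac{a^{\xi(t+1)}}{(ab)^{\lfloor t/2\rfloor}}\alpha^{t}e_{t},\quad \beta^{*}=\sum_{t=0}^{7}\frac{a^{\xi(t+1)}}{(ab)^{\lfloor t/2\rfloor}}\beta^{t}e_{t},$$ $$\alpha^{**}=\sum_{t=0}^{7}\frac{a^{\xi(t)}}{(ab)^{\lfloor (t+1)/2\rfloor}}\alpha^{t}e_{t},\quad \beta^{**}=\sum_{t=0}^{7}\frac{a^{\xi(t)}}{(ab)^{\lfloor (t+1)/2\rfloor}}\beta^{t}e_{t},$$ the following hold for every positive integer $n$: (i) $$\sum_{r=0}^{n-1}O_r(a,b)=\frac{O_{n+1}(a,b)+O_n(a,b)-O_{n-1}(a,b)-O_{n-2}(a,b)}{ab}+\frac{\alpha^{*}\beta-\beta^{*}\alpha-\alpha^{**}ab+\beta^{**}ab}{ab(\alpha-\beta)};$$ (ii) $$\sum_{r=0}^{n-1}O_{2r}(a,b)=\frac{O_{2n}(a,b)-O_{2n-2}(a,b)}{ab}+\frac{\alpha^{*}\beta-\beta^{*}\alpha}{ab(\alpha-\beta)};$$ (iii) $$\sum_{r=0}^{n-1}O_{2r+1}(a,b)=\frac{O_{2n+1}(a,b)-O_{2n-1}(a,b)}{ab}-\frac{\alpha^{**}-\beta^{**}}{\alpha-\beta}.$$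
   Context: The bi-periodic Fibonacci sequence with nonzero real parameters $a,b$ is defined by $q_0=0$, $q_1=1$ and, for $n\ge 2$, $q_n=aq_{n-1}+q_{n-2}$ if $n$ is even, $q_n=bq_{n-1}+q_{n-2}$ if $n$ is odd; for negative indices, $q_{-n}=(-1)^{n-1}q_n$. $\xi(n)=n-2\lfloor n/2\rfloor$, i.e. $\xi(n)=0$ for $n$ even and $\xi(n)=1$ for $n$ odd. $e_0=1,e_1,\dots,e_7$ is the standard basis of the real octonion algebra $\mathcal{O}$. The bi-periodic Fibonacci octonions are $O_n(a,b)=\sum_{s=0}^{7}q_{n+s}e_s$ for $n\ge 0$, and for negative subscripts $O_{-n}(a,b)=\sum_{s=0}^{7}(-1)^{n-s-1}q_{n-s}e_s$. *)

theory Defs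
  imports Complex_Main
begin

text \<open>
  Octonions with coefficients in \<open>'a\<close>. The type \<open>real octonion\<close> is the real octonion algebra;
  \<open>complex octonion\<close> is its complexification, which is needed because the roots of the
  characteristic polynomial, and hence the starred coefficients below, need not be real.
\<close>

datatype 'a octonion =
  Octonion (c0: 'a) (c1: 'a) (c2: 'a) (c3: 'a) (c4: 'a) (c5: 'a) (c6: 'a) (c7: 'a)

instantiation octonion :: (ab_group_add) ab_group_add
begin

definition "0 = Octonion 0 0 0 0 0 0 0 0"

definition "x + y = Octonion (c0 x + c0 y) (c1 x + c1 y) (c2 x + c2 y) (c3 x + c3 y)
                             (c4 x + c4 y) (c5 x + c5 y) (c6 x + c6 y) (c7 x + c7 y)"

definition "- x = Octonion (- c0 x) (- c1 x) (- c2 x) (- c3 x)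
                           (- c4 x) (- c5 x) (- c6 x) (- c7 x)"

definition "x - y = Octonion (c0 x - c0 y) (c1 x - c1 y) (c2 x - c2 y) (c3 x - c3 y)
                             (c4 x - c4 y) (c5 x - c5 y) (c6 x - c6 y) (c7 x - c7 y)"

instance
  by standard
    (simp_all add: zero_octonion_def plus_octonion_def uminus_octonion_def minus_octonion_def
       algebra_simps)

end

text \<open>
  The product is the Cayley-Dickson product
  \<open>(p, q) (r, s) = (p r - s\<^sup>* q, s p + q r\<^sup>*)\<close> of pairs of quaternions, with
  \<open>p = (c0, c1, c2, c3)\<close> and \<open>q = (c4, c5, c6, c7)\<close>.
\<close>

instantiation octonion :: (comm_ring_1) "{one, times}"
begin

definition "1 = Octonion 1 0 0 0 0 0 0 0"

definition
  "x * y = Octonion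
      (c0 x * c0 y - c1 x * c1 y - c2 x * c2 y - c3 x * c3 y - c4 x * c4 y - c5 x * c5 y - c6 x * c6 y - c7 x * c7 y)
      (c0 x * c1 y + c1 x * c0 y + c2 x * c3 y - c3 x * c2 y + c4 x * c5 y - c5 x * c4 y - c6 x * c7 y + c7 x * c6 y)
      (c0 x * c2 y - c1 x * c3 y + c2 x * c0 y + c3 x * c1 y + c4 x * c6 y + c5 x * c7 y - c6 x * c4 y - c7 x * c5 y)
      (c0 x * c3 y + c1 x * c2 y - c2 x * c1 y + c3 x * c0 y + c4 x * c7 y - c5 x * c6 y + c6 x * c5 y - c7 x * c4 y)
      (c0 x * c4 y - c1 x * c5 y - c2 x * c6 y - c3 x * c7 y + c4 x * c0 y + c5 x * c1 y + c6 x * c2 y + c7 x * c3 y)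
      (c0 x * c5 y + c1 x * c4 y - c2 x * c7 y + c3 x * c6 y - c4 x * c1 y + c5 x * c0 y - c6 x * c3 y + c7 x * c2 y)
      (c0 x * c6 y + c1 x * c7 y + c2 x * c4 y - c3 x * c5 y - c4 x * c2 y + c5 x * c3 y + c6 x * c0 y - c7 x * c1 y)
      (c0 x * c7 y - c1 x * c6 y + c2 x * c5 y + c3 x * c4 y - c4 x * c3 y - c5 x * c2 y + c6 x * c1 y + c7 x * c0 y)"

instance ..

end

definition oct_scale :: "'a::times \<Rightarrow> 'a octonion \<Rightarrow> 'a octonion"  (infixr "*\<^sub>o" 75)
  where "k *\<^sub>o x = Octonion (k * c0 x) (k * c1 x) (k * c2 x) (k * c3 x)
                         (k * c4 x) (k * c5 x) (k * c6 x) (k * c7 x)"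

interpretation octonion: vector_space "oct_scale :: 'a::field \<Rightarrow> 'a octonion \<Rightarrow> 'a octonion"
  by standard (simp_all add: oct_scale_def plus_octonion_def algebra_simps)

text \<open>The standard basis \<open>e\<^sub>0, \<dots>, e\<^sub>7\<close>; indices above 7 are not used.\<close>

definition oct_basis :: "nat \<Rightarrow> 'a::zero_neq_one octonion"
  where "oct_basis s = Octonion (of_bool (s = 0)) (of_bool (s = 1)) (of_bool (s = 2))
    (of_bool (s = 3)) (of_bool (s = 4)) (of_bool (s = 5)) (of_bool (s = 6)) (of_bool (s = 7))"

lemma oct_basis_0: "oct_basis 0 = (1 :: 'a::comm_ring_1 octonion)"
  by (simp add: oct_basis_def one_octonion_def)

lemma oct_one_times: "1 * x = x" and oct_times_one: "x * 1 = x"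
  for x :: "'a::comm_ring_1 octonion"
  by (simp_all add: one_octonion_def times_octonion_def)

lemma oct_basis_times:
  "oct_basis 1 * oct_basis 2 = (oct_basis 3 :: 'a::comm_ring_1 octonion)"
  "oct_basis 1 * oct_basis 4 = (oct_basis 5 :: 'a octonion)"
  "oct_basis 2 * oct_basis 4 = (oct_basis 6 :: 'a octonion)"
  "oct_basis 3 * oct_basis 4 = (oct_basis 7 :: 'a octonion)"
  by (simp_all add: oct_basis_def times_octonion_def)

abbreviation complexify :: "real octonion \<Rightarrow> complex octonion"
  where "complexify \<equiv> map_octonion complex_of_real"

definition xi :: "nat \<Rightarrow> nat"
  where "xi n = n - 2 * (n div 2)"

fun bp_fib_nat :: "real \<Rightarrow> real \<Rightarrow> nat \<Rightarrow> real"
  where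
    "bp_fib_nat a b 0 = 0"
  | "bp_fib_nat a b (Suc 0) = 1"
  | "bp_fib_nat a b (Suc (Suc n)) =
       (if even (Suc (Suc n)) then a else b) * bp_fib_nat a b (Suc n) + bp_fib_nat a b n"

definition bp_fib :: "real \<Rightarrow> real \<Rightarrow> int \<Rightarrow> real"
  where "bp_fib a b k = (if k \<ge> 0 then bp_fib_nat a b (nat k)
                         else (-1) powi (- k - 1) * bp_fib_nat a b (nat (- k)))"

text \<open>For \<open>n < 0\<close> this is the formula for \<open>O\<^sub>-\<^sub>m\<close> with \<open>m = - n\<close>.\<close>

definition bp_fib_oct :: "real \<Rightarrow> real \<Rightarrow> int \<Rightarrow> real octonion"
  where "bp_fib_oct a b n =
    (if n \<ge> 0 then (\<Sum>s\<le>7. bp_fib a b (n + int s) *\<^sub>o oct_basis s)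
     else (\<Sum>s\<le>7. ((-1) powi (- n - int s - 1) * bp_fib a b (- n - int s)) *\<^sub>o oct_basis s))"

text \<open>
  For a root \<open>x\<close> of the characteristic polynomial, \<open>oct_star a b x\<close> is \<open>x\<^sup>*\<close> and
  \<open>oct_star2 a b x\<close> is \<open>x\<^sup>*\<^sup>*\<close>.
\<close>

definition oct_star :: "real \<Rightarrow> real \<Rightarrow> complex \<Rightarrow> complex octonion"
  where "oct_star a b x =
    (\<Sum>t\<le>7. (complex_of_real (a ^ xi (t + 1) / (a * b) ^ (t div 2)) * x ^ t) *\<^sub>o oct_basis t)"

definition oct_star2 :: "real \<Rightarrow> real \<Rightarrow> complex \<Rightarrow> complex octonion"
  where "oct_star2 a b x =
    (\<Sum>t\<le>7. (complex_of_real (a ^ xi t / (a * b) ^ ((t + 1) div 2)) * x ^ t) *\<^sub>o oct_basis t)"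

end

theory Submission
  imports Defs
begin

text \<open>
  The sequence, extended to all integers, satisfies
  \<open>q (k + 2) - 2 q k + q (k - 2) = a b q k\<close> for \<open>k\<close> of either parity, because two steps of the
  alternating recurrence always use each of \<open>a\<close> and \<open>b\<close> once. Since the
  coordinates of \<open>O\<^sub>n\<close> are \<open>q (n + s)\<close> for positive and negative \<open>n\<close> alike, the octonions satisfy the same relation
  (\<open>bp_fib_oct_second_difference\<close>). Thus \<open>a b O\<^sub>k\<close> is the increment from
  \<open>O\<^sub>k - O\<^sub>k\<^sub>-\<^sub>2\<close> to \<open>O\<^sub>k\<^sub>+\<^sub>2 - O\<^sub>k\<close>, and all three sums telescope. What remains is a boundary
  contribution at the lower end: \<open>O\<^sub>0 - O\<^sub>-\<^sub>2\<close> for the even sum, \<open>O\<^sub>1 - O\<^sub>-\<^sub>1\<close> for the odd sum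
  and the sum of both for the full one.

  The boundary contributions are real octonions, whereas the claim expresses them by the possibly
  non-real roots. Each of their coordinates is of the form \<open>q (k + 1) - q (k - 1)\<close>, which the
  recurrence turns into \<open>a q k\<close> or \<open>b q k\<close>, and Binet's formula
  (\<open>bp_fib_binet\<close>) rewrites \<open>q k\<close> by the roots; the coefficients of the starred octonions are
  exactly what this yields (\<open>oct_star2_boundary\<close>, \<open>oct_star_boundary\<close>).
\<close>

section \<open>The bi-periodic Fibonacci numbers on all integers\<close>

lemma bp_fib_uminus: "bp_fib a b (- k) = (-1) powi (k - 1) * bp_fib a b k"
proof (cases "k < 0")
  case True
  have "(-1 :: real) powi (k - 1) * (-1) powi (- k - 1) = 1"
    by (simp add: power_int_minus_left)
  with True show ?thesis
    by (simp add: bp_fib_def mult.assoc [symmetric])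
qed (auto simp: bp_fib_def)

lemma bp_fib_of_nat: "bp_fib a b (int n) = bp_fib_nat a b n"
  by (simp add: bp_fib_def)

text \<open>
  The sign in the definition at negative indices is the one for which the recurrence runs
  through \<open>0\<close> without a change.
\<close>

lemma bp_fib_rec:
  "bp_fib a b (k + 1) = (if even k then b else a) * bp_fib a b k + bp_fib a b (k - 1)"
proof (cases k)
  case (nonneg n)
  show ?thesis
  proof (cases n)
    case 0
    with nonneg show ?thesis
      by (simp add: bp_fib_def)
  next
    case (Suc m)
    have "k + 1 = int (Suc (Suc m))" "k = int (Suc m)" "k - 1 = int m"
      using nonneg Suc by simp_all
    then show ?thesis
      by (simp only: bp_fib_of_nat bp_fib_nat.simps even_of_nat even_Suc) simp
  qed
next
  case (neg n)
  have "bp_fib a b (k + 1) = (-1) powi (int n - 1) * bp_fib_nat a b n"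
    "bp_fib a b k = (-1) powi int n * bp_fib_nat a b (Suc n)"
    "bp_fib a b (k - 1) = (-1) powi (int n + 1) * bp_fib_nat a b (Suc (Suc n))"
    using bp_fib_uminus [of a b "int n"] bp_fib_uminus [of a b "int (Suc n)"]
      bp_fib_uminus [of a b "int (Suc (Suc n))"]
    unfolding bp_fib_of_nat by (simp_all add: neg)
  moreover have "even k = odd n"
    using neg by simp
  ultimately show ?thesis
    by (simp add: power_int_minus_left)
qed

lemma bp_fib_second_difference:
  "bp_fib a b (k + 2) - bp_fib a b k - (bp_fib a b k - bp_fib a b (k - 2)) = a * b * bp_fib a b k"
  using bp_fib_rec [of a b "k + 1"] bp_fib_rec [of a b k] bp_fib_rec [of a b "k - 1"]
  by (cases "even k") (simp_all add: algebra_simps)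

section \<open>Octonions by coordinates\<close>

text \<open>
  All octonions in the theorem are given as combinations of the standard basis, so identities
  between them reduce to identities between coordinates once linear operations are moved inside.
\<close>

definition oct_of_coords :: "(nat \<Rightarrow> 'a) \<Rightarrow> 'a::field octonion"
  where "oct_of_coords f = (\<Sum>s\<le>7. f s *\<^sub>o oct_basis s)"

lemma oct_of_coords_add: "oct_of_coords f + oct_of_coords g = oct_of_coords (\<lambda>s. f s + g s)"
  by (simp add: oct_of_coords_def octonion.scale_left_distrib sum.distrib)

lemma oct_of_coords_diff: "oct_of_coords f - oct_of_coords g = oct_of_coords (\<lambda>s. f s - g s)"
  by (simp add: oct_of_coords_def octonion.scale_left_diff_distrib sum_subtractf)

lemma oct_of_coords_scale: "c *\<^sub>o oct_of_coords f = oct_of_coords (\<lambda>s. c * f s)"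
  by (simp add: oct_of_coords_def octonion.scale_sum_right)

lemma complexify_add: "complexify (x + y) = complexify x + complexify y"
  by (simp add: plus_octonion_def octonion.map_sel)

lemma complexify_diff: "complexify (x - y) = complexify x - complexify y"
  by (simp add: minus_octonion_def octonion.map_sel)

lemma complexify_scale: "complexify (c *\<^sub>o x) = of_real c *\<^sub>o complexify x"
  by (simp add: oct_scale_def octonion.map_sel)

lemma complexify_sum: "complexify (sum f A) = (\<Sum>i\<in>A. complexify (f i))"
  by (induction A rule: infinite_finite_induct) (simp_all add: complexify_add zero_octonion_def)

lemma complexify_oct_basis: "complexify (oct_basis s) = oct_basis s"
  by (simp add: oct_basis_def)

lemma complexify_oct_of_coords:
  "complexify (oct_of_coords f) = oct_of_coords (\<lambda>s. of_real (f s))"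
  by (simp add: oct_of_coords_def complexify_sum complexify_scale complexify_oct_basis)

section \<open>Telescoping sums\<close>

text \<open>
  At negative subscripts the sign in the definition of \<open>O\<^sub>n\<close> is the reflection sign of \<open>q\<close>, so the
  two branches of that definition have the same coordinates.
\<close>

lemma bp_fib_oct_coords: "bp_fib_oct a b n = oct_of_coords (\<lambda>s. bp_fib a b (n + int s))"
proof -
  have "(-1) powi (- n - int s - 1) * bp_fib a b (- n - int s) = bp_fib a b (n + int s)" for s
    using bp_fib_uminus [of a b "- n - int s"] by (simp add: add.commute)
  then show ?thesis
    by (simp add: bp_fib_oct_def oct_of_coords_def)
qed

lemma bp_fib_oct_second_difference:
  "bp_fib_oct a b (k + 2) - bp_fib_oct a b k - (bp_fib_oct a b k - bp_fib_oct a b (k - 2))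
     = (a * b) *\<^sub>o bp_fib_oct a b k"
proof -
  have "bp_fib a b (k + 2 + int s) - bp_fib a b (k + int s)
      - (bp_fib a b (k + int s) - bp_fib a b (k - 2 + int s)) = a * b * bp_fib a b (k + int s)"
    for s
    using bp_fib_second_difference [of a b "k + int s"] by (simp add: algebra_simps)
  then show ?thesis
    by (simp add: bp_fib_oct_coords oct_of_coords_diff oct_of_coords_scale)
qed

text \<open>
  The offset \<open>m\<close> lets one telescoping argument serve for the even sum, \<open>m = 0\<close>, and the odd sum,
  \<open>m = 1\<close>.
\<close>

lemma bp_fib_oct_sum_step2:
  assumes "a * b \<noteq> 0"
  shows "(\<Sum>r<n. bp_fib_oct a b (2 * int r + m)) =
    (1 / (a * b)) *\<^sub>o (bp_fib_oct a b (2 * int n + m) - bp_fib_oct a b (2 * int n + m - 2))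
    - (1 / (a * b)) *\<^sub>o (bp_fib_oct a b m - bp_fib_oct a b (m - 2))"
proof -
  define D where "D r = (1 / (a * b)) *\<^sub>o
    (bp_fib_oct a b (2 * int r + m) - bp_fib_oct a b (2 * int r + m - 2))" for r
  have "bp_fib_oct a b (2 * int r + m) = D (Suc r) - D r" for r
  proof -
    have "D (Suc r) - D r = (1 / (a * b)) *\<^sub>o (a * b) *\<^sub>o bp_fib_oct a b (2 * int r + m)"
      unfolding D_def octonion.scale_right_diff_distrib [symmetric]
        bp_fib_oct_second_difference [symmetric]
      by (simp add: algebra_simps)
    then show ?thesis
      using assms by simp
  qed
  then have "(\<Sum>r<n. bp_fib_oct a b (2 * int r + m)) = D n - D 0"
    by (simp only: sum_lessThan_telescope)
  then show ?thesis
    by (simp add: D_def)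
qed

lemma bp_fib_oct_sum:
  assumes "a * b \<noteq> 0"
  shows "(\<Sum>r<n. bp_fib_oct a b (int r)) =
    (1 / (a * b)) *\<^sub>o (bp_fib_oct a b (int n + 1) + bp_fib_oct a b (int n)
      - bp_fib_oct a b (int n - 1) - bp_fib_oct a b (int n - 2))
    - (1 / (a * b)) *\<^sub>o (bp_fib_oct a b 0 - bp_fib_oct a b (- 2))
    - (1 / (a * b)) *\<^sub>o (bp_fib_oct a b 1 - bp_fib_oct a b (- 1))"
proof -
  \<comment> \<open>The increments of \<open>O\<^sub>k - O\<^sub>k\<^sub>-\<^sub>2\<close> come in steps of two. Adding the differences for \<open>k = r\<close> and
    \<open>k = r + 1\<close>, one of each parity, gives a quantity that telescopes in steps of one.\<close>
  define D where "D r = (1 / (a * b)) *\<^sub>o (bp_fib_oct a b (int r + 1) + bp_fib_oct a b (int r)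
      - bp_fib_oct a b (int r - 1) - bp_fib_oct a b (int r - 2))" for r
  have "bp_fib_oct a b (int r) = D (Suc r) - D r" for r
  proof -
    have "D (Suc r) - D r = (1 / (a * b)) *\<^sub>o (a * b) *\<^sub>o bp_fib_oct a b (int r)"
      unfolding D_def octonion.scale_right_diff_distrib [symmetric]
        bp_fib_oct_second_difference [symmetric]
      by (simp add: algebra_simps)
    then show ?thesis
      using assms by simp
  qed
  then have "(\<Sum>r<n. bp_fib_oct a b (int r)) = D n - D 0"
    by (simp only: sum_lessThan_telescope)
  moreover have "D 0 = (1 / (a * b)) *\<^sub>o (bp_fib_oct a b 0 - bp_fib_oct a b (- 2))
      + (1 / (a * b)) *\<^sub>o (bp_fib_oct a b 1 - bp_fib_oct a b (- 1))"
    unfolding D_def octonion.scale_right_distrib [symmetric] by (simp add: algebra_simps)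
  ultimately show ?thesis
    unfolding D_def by (simp add: algebra_simps)
qed

section \<open>Binet's formula and the boundary contributions\<close>

lemma vieta_of_root_set:
  fixes \<alpha> \<beta> p q :: "'a::idom"
  assumes roots: "{x. x\<^sup>2 - p * x - q = 0} = {\<alpha>, \<beta>}" and distinct: "\<alpha> \<noteq> \<beta>"
  shows "\<alpha> + \<beta> = p" "\<alpha> * \<beta> = - q"
proof -
  have \<alpha>: "\<alpha>\<^sup>2 - p * \<alpha> - q = 0" and \<beta>: "\<beta>\<^sup>2 - p * \<beta> - q = 0"
    using roots by blast+
  have "(\<alpha> - \<beta>) * (\<alpha> + \<beta> - p) = (\<alpha>\<^sup>2 - p * \<alpha> - q) - (\<beta>\<^sup>2 - p * \<beta> - q)"
    by (simp add: algebra_simps power2_eq_square)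
  then show sum: "\<alpha> + \<beta> = p"
    using \<alpha> \<beta> distinct by simp
  show "\<alpha> * \<beta> = - q"
    using \<alpha> unfolding sum [symmetric]
    by (simp add: algebra_simps power2_eq_square minus_equation_iff [of _ q] equation_minus_iff)
qed

lemma xi_eq: "xi n = of_bool (odd n)"
  by (simp add: xi_def minus_mult_div_eq_mod mod2_eq_if)

context
  fixes a b :: real and \<alpha> \<beta> :: complex
  assumes nonzero: "a \<noteq> 0" "b \<noteq> 0"
    and root_sum: "\<alpha> + \<beta> = of_real (a * b)"
    and root_prod: "\<alpha> * \<beta> = - of_real (a * b)"
    and distinct: "\<alpha> \<noteq> \<beta>"
begin

text \<open>
  The power differences satisfy a recurrence with constant coefficients; dividing by the powers
  of \<open>a b\<close> and inserting \<open>a\<close> at the even indices turns it into the alternating one.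
\<close>

lemma power_diff_rec:
  "\<alpha> ^ Suc (Suc n) - \<beta> ^ Suc (Suc n)
     = of_real (a * b) * ((\<alpha> ^ Suc n - \<beta> ^ Suc n) + (\<alpha> ^ n - \<beta> ^ n))"
proof -
  have "\<alpha> ^ Suc (Suc n) - \<beta> ^ Suc (Suc n)
      = (\<alpha> + \<beta>) * (\<alpha> ^ Suc n - \<beta> ^ Suc n) - \<alpha> * \<beta> * (\<alpha> ^ n - \<beta> ^ n)"
    by (simp add: algebra_simps)
  then show ?thesis
    by (simp add: root_sum root_prod algebra_simps)
qed

lemma bp_fib_binet:
  "complex_of_real (bp_fib a b (int n)) * (\<alpha> - \<beta>)
     = of_real (a ^ xi (n + 1) / (a * b) ^ (n div 2)) * (\<alpha> ^ n - \<beta> ^ n)"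
proof (induction n rule: induct_nat_012)
  case (ge2 n)
  have "bp_fib a b (int (Suc (Suc n)))
      = (if even n then a else b) * bp_fib a b (int (Suc n)) + bp_fib a b (int n)"
    by (simp only: bp_fib_of_nat bp_fib_nat.simps even_Suc) simp
  then have "complex_of_real (bp_fib a b (int (Suc (Suc n)))) * (\<alpha> - \<beta>)
      = of_real (if even n then a else b) * (complex_of_real (bp_fib a b (int (Suc n))) * (\<alpha> - \<beta>))
        + complex_of_real (bp_fib a b (int n)) * (\<alpha> - \<beta>)"
    by (simp only: of_real_add of_real_mult) (simp add: algebra_simps)
  also have "\<dots> = of_real (a ^ xi (Suc (Suc n) + 1) / (a * b) ^ (Suc (Suc n) div 2))
      * (\<alpha> ^ Suc (Suc n) - \<beta> ^ Suc (Suc n))"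
  proof -
    have "(if even n then a else b) * (a ^ xi (Suc n + 1) / (a * b) ^ (Suc n div 2))
        = a ^ xi (Suc (Suc n) + 1) / (a * b) ^ (Suc (Suc n) div 2) * (a * b)"
      "a ^ xi (n + 1) / (a * b) ^ (n div 2)
        = a ^ xi (Suc (Suc n) + 1) / (a * b) ^ (Suc (Suc n) div 2) * (a * b)"
      using nonzero by (auto elim!: evenE oddE simp: xi_eq)
    then show ?thesis
      unfolding ge2 power_diff_rec mult.assoc [symmetric] of_real_mult [symmetric]
      by (simp only: distrib_left mult.assoc [symmetric])
  qed
  finally show ?case .
qed (simp_all add: bp_fib_def xi_eq)

text \<open>
  The coordinate \<open>q (s + 1) - q (s - 1)\<close> of the boundary contribution is \<open>b q s\<close> for even \<open>s\<close>
  and \<open>a q s\<close> for odd \<open>s\<close>; this factor accounts for the shifted exponents in \<open>\<alpha>\<^sup>*\<^sup>*\<close>.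
\<close>

lemma oct_star2_boundary:
  "(1 / (\<alpha> - \<beta>)) *\<^sub>o (oct_star2 a b \<alpha> - oct_star2 a b \<beta>)
     = complexify ((1 / (a * b)) *\<^sub>o (bp_fib_oct a b 1 - bp_fib_oct a b (- 1)))"
proof -
  have coord: "1 / (\<alpha> - \<beta>) *
      (complex_of_real (a ^ xi s / (a * b) ^ ((s + 1) div 2)) * \<alpha> ^ s
       - complex_of_real (a ^ xi s / (a * b) ^ ((s + 1) div 2)) * \<beta> ^ s)
      = of_real (1 / (a * b) * (bp_fib a b (1 + int s) - bp_fib a b (- 1 + int s)))" for s
  proof -
    have ne: "complex_of_real a \<noteq> 0" "complex_of_real b \<noteq> 0" "\<alpha> - \<beta> \<noteq> 0"
      using nonzero distinct by simp_all
    have diff: "bp_fib a b (1 + int s) - bp_fib a b (- 1 + int s)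
        = (if even s then b else a) * bp_fib a b (int s)"
      using bp_fib_rec [of a b "int s"] by (simp add: algebra_simps)
    have "complex_of_real (a ^ xi s / (a * b) ^ ((s + 1) div 2)) * (\<alpha> ^ s - \<beta> ^ s)
        = of_real (1 / (a * b) * (if even s then b else a))
          * (complex_of_real (bp_fib a b (int s)) * (\<alpha> - \<beta>))"
      unfolding bp_fib_binet using ne
      by (cases "even s") (auto elim!: evenE oddE simp: xi_eq)
    then show ?thesis
      unfolding diff using ne by (simp add: field_simps)
  qed
  show ?thesis
    unfolding oct_star2_def oct_of_coords_def [symmetric] bp_fib_oct_coords oct_of_coords_diff
      oct_of_coords_scale complexify_oct_of_coords coord ..
qed

text \<open>
  Because \<open>\<alpha> \<beta> = - a b\<close>, the difference \<open>\<beta> \<alpha>\<^sup>s - \<alpha> \<beta>\<^sup>s\<close> is a power difference with exponent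
  \<open>s - 1\<close>, up to the factor \<open>- a b\<close>; hence the minus sign and the index shift.
\<close>

lemma oct_star_boundary:
  "(1 / (of_real (a * b) * (\<alpha> - \<beta>))) *\<^sub>o (\<beta> *\<^sub>o oct_star a b \<alpha> - \<alpha> *\<^sub>o oct_star a b \<beta>)
     = - complexify ((1 / (a * b)) *\<^sub>o (bp_fib_oct a b 0 - bp_fib_oct a b (- 2)))"
proof -
  have coord: "1 / (of_real (a * b) * (\<alpha> - \<beta>)) *
      (\<beta> * (complex_of_real (a ^ xi (s + 1) / (a * b) ^ (s div 2)) * \<alpha> ^ s)
       - \<alpha> * (complex_of_real (a ^ xi (s + 1) / (a * b) ^ (s div 2)) * \<beta> ^ s))
      = - 1 * of_real (1 / (a * b) * (bp_fib a b (0 + int s) - bp_fib a b (- 2 + int s)))" for s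
  proof (cases s)
    \<comment> \<open>The exponent \<open>s - 1\<close> would be negative, so this coordinate is computed from
      \<open>q (- 2) = - a\<close>.\<close>
    case 0
    have "1 / (of_real (a * b) * (\<alpha> - \<beta>)) * (\<beta> * of_real a - \<alpha> * of_real a)
        = - complex_of_real (1 / b)"
      using nonzero distinct by (simp add: field_simps)
    with 0 show ?thesis
      using nonzero by (simp add: bp_fib_def xi_eq numeral_2_eq_2)
  next
    case (Suc t)
    have ne: "complex_of_real a \<noteq> 0" "complex_of_real b \<noteq> 0" "\<alpha> - \<beta> \<noteq> 0"
      using nonzero distinct by simp_all
    have diff: "bp_fib a b (0 + int s) - bp_fib a b (- 2 + int s)
        = (if even t then b else a) * bp_fib a b (int t)"
      using bp_fib_rec [of a b "int t"] by (simp add: Suc algebra_simps)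
    have "\<beta> * \<alpha> ^ s - \<alpha> * \<beta> ^ s = \<alpha> * \<beta> * (\<alpha> ^ t - \<beta> ^ t)"
      by (simp add: Suc algebra_simps)
    then have power: "\<beta> * \<alpha> ^ s - \<alpha> * \<beta> ^ s = - of_real (a * b) * (\<alpha> ^ t - \<beta> ^ t)"
      by (simp only: root_prod)
    define c where "c = complex_of_real (a ^ xi (s + 1) / (a * b) ^ (s div 2))"
    have "c * (\<alpha> ^ t - \<beta> ^ t) = of_real (1 / (a * b) * (if even t then b else a))
          * (complex_of_real (bp_fib a b (int t)) * (\<alpha> - \<beta>))"
      unfolding bp_fib_binet c_def using ne
      by (cases "even t") (auto elim!: evenE oddE simp: xi_eq Suc)
    then have *: "c * (\<alpha> ^ t - \<beta> ^ t) / (\<alpha> - \<beta>) = of_real (1 / (a * b)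
        * (bp_fib a b (0 + int s) - bp_fib a b (- 2 + int s)))"
      unfolding diff using ne by simp
    have "1 / (of_real (a * b) * (\<alpha> - \<beta>)) * (\<beta> * (c * \<alpha> ^ s) - \<alpha> * (c * \<beta> ^ s))
        = 1 / (of_real (a * b) * (\<alpha> - \<beta>)) * (c * (\<beta> * \<alpha> ^ s - \<alpha> * \<beta> ^ s))"
      by (simp add: algebra_simps)
    also have "\<dots> = - 1 * (c * (\<alpha> ^ t - \<beta> ^ t) / (\<alpha> - \<beta>))"
      unfolding power using ne by simp
    also have "\<dots> = - 1 * of_real (1 / (a * b)
        * (bp_fib a b (0 + int s) - bp_fib a b (- 2 + int s)))"
      by (simp only: *)
    finally show ?thesis
      unfolding c_def .
  qed
  have minus: "- x = (- 1) *\<^sub>o x" for x :: "complex octonion"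
    by simp
  show ?thesis
    unfolding minus oct_star_def oct_of_coords_def [symmetric] bp_fib_oct_coords oct_of_coords_diff
      oct_of_coords_scale complexify_oct_of_coords coord ..
qed

end

section \<open>The sum formulas\<close>

theorem theorem2p5:
  fixes a b :: real and \<alpha> \<beta> :: complex and n :: nat
  assumes "a \<noteq> 0" and "b \<noteq> 0"
    and roots: "{x :: complex. x\<^sup>2 - of_real (a * b) * x - of_real (a * b) = 0} = {\<alpha>, \<beta>}"
    and distinct: "\<alpha> \<noteq> \<beta>"
    and "n > 0"
  shows
    "complexify (\<Sum>r<n. bp_fib_oct a b (int r)) =
       complexify ((1 / (a * b)) *\<^sub>o
         (bp_fib_oct a b (int n + 1) + bp_fib_oct a b (int n)
          - bp_fib_oct a b (int n - 1) - bp_fib_oct a b (int n - 2)))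
       + (1 / (of_real (a * b) * (\<alpha> - \<beta>))) *\<^sub>o
         (\<beta> *\<^sub>o oct_star a b \<alpha> - \<alpha> *\<^sub>o oct_star a b \<beta>
          - of_real (a * b) *\<^sub>o oct_star2 a b \<alpha> + of_real (a * b) *\<^sub>o oct_star2 a b \<beta>)
     \<and>
     complexify (\<Sum>r<n. bp_fib_oct a b (2 * int r)) =
       complexify ((1 / (a * b)) *\<^sub>o
         (bp_fib_oct a b (2 * int n) - bp_fib_oct a b (2 * int n - 2)))
       + (1 / (of_real (a * b) * (\<alpha> - \<beta>))) *\<^sub>o
         (\<beta> *\<^sub>o oct_star a b \<alpha> - \<alpha> *\<^sub>o oct_star a b \<beta>)
     \<and>
     complexify (\<Sum>r<n. bp_fib_oct a b (2 * int r + 1)) =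
       complexify ((1 / (a * b)) *\<^sub>o
         (bp_fib_oct a b (2 * int n + 1) - bp_fib_oct a b (2 * int n - 1)))
       - (1 / (\<alpha> - \<beta>)) *\<^sub>o (oct_star2 a b \<alpha> - oct_star2 a b \<beta>)"
proof -
  have ne: "a * b \<noteq> 0" and ne': "complex_of_real (a * b) \<noteq> 0"
    using assms(1,2) by simp_all
  note vieta = vieta_of_root_set [OF roots distinct]
  note star = oct_star_boundary [OF assms(1,2) vieta distinct]
  note star2 = oct_star2_boundary [OF assms(1,2) vieta distinct]
  have split: "(1 / (of_real (a * b) * (\<alpha> - \<beta>))) *\<^sub>o
         (\<beta> *\<^sub>o oct_star a b \<alpha> - \<alpha> *\<^sub>o oct_star a b \<beta>
          - of_real (a * b) *\<^sub>o oct_star2 a b \<alpha> + of_real (a * b) *\<^sub>o oct_star2 a b \<beta>)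
      = (1 / (of_real (a * b) * (\<alpha> - \<beta>))) *\<^sub>o (\<beta> *\<^sub>o oct_star a b \<alpha> - \<alpha> *\<^sub>o oct_star a b \<beta>)
        - (1 / (\<alpha> - \<beta>)) *\<^sub>o (oct_star2 a b \<alpha> - oct_star2 a b \<beta>)"
  proof -
    have "(1 / (\<alpha> - \<beta>)) *\<^sub>o (oct_star2 a b \<alpha> - oct_star2 a b \<beta>)
        = (1 / (of_real (a * b) * (\<alpha> - \<beta>))) *\<^sub>o of_real (a * b) *\<^sub>o
            (oct_star2 a b \<alpha> - oct_star2 a b \<beta>)"
      using ne' by simp
    then show ?thesis
      by (simp only: octonion.scale_right_diff_distrib octonion.scale_right_distrib) simp
  qed
  show ?thesis
    unfolding split star star2
    using bp_fib_oct_sum [OF ne, of n] bp_fib_oct_sum_step2 [OF ne, of 0 n]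
      bp_fib_oct_sum_step2 [OF ne, of 1 n]
    by (simp add: complexify_diff)
qed

end
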